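(* Let $z^\ast\in\Omega$ be a solution of the variational inequality and let $(z_k)_{k\ge 0}$ be the sequence generated by the fOGDA-VI algorithm (described in the context), with $\alpha>2$ and $0<\gamma<\frac{1}{4L}$. Then, as $k\to+\infty$, $$\mathrm{Gap}(z_k)=o\left(\frac1k\right)\quad\text{and}\quad \mathrm{Res}(z_k)=o\left(\frac1k\right).$$
   Context: $\mathbb{R}^d$ carries its standard inner product $\langle\cdot,\cdot\rangle$ and induced norm $\|\cdot\|$. $F:\mathbb{R}^d\to\mathbb{R}^d$ is monotone, i.e. $\langle F(w)-F(z),w-z\rangle\ge 0$ for all $w,z$, and $L$-Lipschitz continuous with $L>0$, i.e. $\|F(w)-F(z)\|\le L\|w-z\|$ for all $w,z$. $C\subseteq\mathbb{R}^d$ is nonempty, closed and convex; $P_C$ is the projection onto $C$; $N_C(z)=\{w\in\mathbb{R}^d : \langle v-z,w\rangle\le 0\ \forall v\in C\}$ for $z\in C$ and $N_C(z)=\emptyset$ for $z\notin C$. The solution set $\Omega=\{z^\ast\in C : \langle F(z^\ast),z-z^\ast\rangle\ge 0\ \forall z\in C\}$ is assumed nonempty. Algorithm fOGDA-VI: Choose $\alpha>2$, $0<\gamma<\frac{1}{4L}$, $z_0,w_0\in\mathbb{R}^d$, $z_1\in C$, $\zeta_1\in N_C(z_1)$. For every $k\ge 1$ compute $$w_k = z_k+\frac{k}{k+\alpha}(z_k-z_{k-1})-\gamma\frac{\alpha}{k+\alpha}\bigl(F(w_{k-1})+\zeta_k\bigr),$$ $$z_{k+1}=P_C\Bigl[w_k-\gamma\Bigl(1+\frac{k}{k+\alpha}\Bigr)\bigl(F(w_k)-F(w_{k-1})-\zeta_k\bigr)\Bigr],$$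 $$\zeta_{k+1}=\frac{k+\alpha}{\gamma(2k+\alpha)}(w_k-z_{k+1})-\bigl(F(w_k)-F(w_{k-1})-\zeta_k\bigr).$$ Restricted gap function (for the given $z^\ast\in\Omega$ and the starting point $z_0$): with $\delta(z_0)=\|z^\ast-z_0\|$ and $\mathbb{B}(z;\delta)=\{w\in\mathbb{R}^d:\|w-z\|\le\delta\}$, $$\mathrm{Gap}(z)=\sup_{w\in C\cap\mathbb{B}(z^\ast;\delta(z_0))}\langle F(w),z-w\rangle.$$ Natural residual: $\mathrm{Res}(z)=\|z-P_C[z-F(z)]\|$. *)

theory Defs
  imports "HOL-Analysis.Analysis" "HOL-Library.Landau_Symbols"
begin

definition monotone_operator :: "('a::real_inner \<Rightarrow> 'a) \<Rightarrow> bool" where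
  "monotone_operator F \<longleftrightarrow> (\<forall>w z. inner (F w - F z) (w - z) \<ge> 0)"

definition normal_cone :: "'a::real_inner set \<Rightarrow> 'a \<Rightarrow> 'a set" where
  "normal_cone C z = (if z \<in> C then {w. \<forall>v\<in>C. inner (v - z) w \<le> 0} else {})"

definition vi_solutions :: "('a::real_inner \<Rightarrow> 'a) \<Rightarrow> 'a set \<Rightarrow> 'a set" where
  "vi_solutions F C = {zs \<in> C. \<forall>z\<in>C. inner (F zs) (z - zs) \<ge> 0}"

text \<open>
  \<open>fogda_vi F C \<alpha> \<gamma> z w \<zeta>\<close> says that the sequences \<open>z\<close>, \<open>w\<close>, \<open>\<zeta>\<close> are generated by the
  algorithm fOGDA-VI. The starting points \<open>z 0\<close> and \<open>w 0\<close> are arbitrary; \<open>\<zeta> 0\<close> is not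
  part of the algorithm and is left unconstrained. The projection onto \<open>C\<close> is
  \<^const>\<open>closest_point\<close>.
\<close>

definition fogda_vi ::
  "('a::euclidean_space \<Rightarrow> 'a) \<Rightarrow> 'a set \<Rightarrow> real \<Rightarrow> real \<Rightarrow>
   (nat \<Rightarrow> 'a) \<Rightarrow> (nat \<Rightarrow> 'a) \<Rightarrow> (nat \<Rightarrow> 'a) \<Rightarrow> bool" where
  "fogda_vi F C \<alpha> \<gamma> z w \<zeta> \<longleftrightarrow>
     z 1 \<in> C \<and> \<zeta> 1 \<in> normal_cone C (z 1) \<and>
     (\<forall>k\<ge>1.
        w k = z k + (real k / (real k + \<alpha>)) *\<^sub>R (z k - z (k - 1))
                  - (\<gamma> * (\<alpha> / (real k + \<alpha>))) *\<^sub>R (F (w (k - 1)) + \<zeta> k) \<and>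
        z (k + 1) = closest_point C
          (w k - (\<gamma> * (1 + real k / (real k + \<alpha>))) *\<^sub>R (F (w k) - F (w (k - 1)) - \<zeta> k)) \<and>
        \<zeta> (k + 1) = ((real k + \<alpha>) / (\<gamma> * (2 * real k + \<alpha>))) *\<^sub>R (w k - z (k + 1))
                  - (F (w k) - F (w (k - 1)) - \<zeta> k))"

text \<open>
  For continuous \<open>F\<close>, closed \<open>C\<close> and \<open>zs \<in> C\<close> the supremum is over a nonempty compact set, so
  the real-valued \<open>Sup\<close> is the genuine supremum.
\<close>

definition restricted_gap ::
  "('a::euclidean_space \<Rightarrow> 'a) \<Rightarrow> 'a set \<Rightarrow> 'a \<Rightarrow> 'a \<Rightarrow> 'a \<Rightarrow> real" where
  "restricted_gap F C zs z0 z = (SUP w \<in> C \<inter> cball zs (norm (zs - z0)). inner (F w) (z - w))"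

definition natural_residual :: "('a::euclidean_space \<Rightarrow> 'a) \<Rightarrow> 'a set \<Rightarrow> 'a \<Rightarrow> real" where
  "natural_residual F C z = norm (z - closest_point C (z - F z))"

end

theory Submission
  imports Defs
begin

text \<open>
  With $V_k = \gamma (F(w_{k-1}) + \zeta_k)$ and $d_k = z_k - z_{k-1}$ the algorithm reads
  $(k+\alpha) d_{k+1} = k d_k - \alpha V_{k+1} - 2k (V_{k+1} - V_k)$, where $\zeta_k \in N_C(z_k)$,
  so that $V_k$ differs from a value of the monotone operator $\gamma (F + N_C)$ at $z_k$ only by
  $e_k = \gamma (F(w_{k-1}) - F(z_k))$, which is at most
  $\theta \|V_k - V_{k-1}\|$ with $\theta = 2 \gamma L < 1/2$.
  Let $p_k = \frac{\alpha-1}{2} \|z_k - z^*\|^2 + \langle z_k - z^*, k d_k + 2k V_k\rangle$ and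
  $H_k = \frac12 \|k d_k + k V_k\|^2 + \frac12 \|k V_k\|^2 + k^2 \langle d_k, e_k\rangle
    + \frac12 k^2 \|V_k - V_{k-1}\|^2$.
  For every $\kappa \in (1, \alpha-1)$ the energy $\kappa p_k + H_k$ is nonnegative and decreases up
  to a summable relative error, by at least a multiple of
  $k \|d_{k+1}\|^2 + k \|V_{k+1}\|^2 + k^2 \|V_{k+1} - V_k\|^2$. Since the energy is affine in
  $\kappa$, using two values of $\kappa$ shows that $H_k$ converges; as $\sum_k H_k / k$
  is finite, the limit is $0$, whence $k \|V_k\| \to 0$. Gap and residual are bounded by
  multiples of $\|F(z_k) + \zeta_k\|$.
\<close>

section \<open>Convergence of real sequences\<close>

text \<open>The relative error costs at most a factor
  \<open>1 / (1 - c n) \<le> exp (2 * c n)\<close> per step, and these factors have a bounded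
  product, so \<open>G\<close> is bounded. The error is then summable in absolute terms and can be
  telescoped away. It is measured against \<open>G (Suc n)\<close> because the error in the energy
  estimate involves the new iterate.\<close>

lemma perturbed_descent:
  fixes G R c :: "nat \<Rightarrow> real"
  assumes G: "\<And>n. 0 \<le> G n" and R: "\<And>n. 0 \<le> R n"
    and c: "\<And>n. 0 \<le> c n" "\<And>n. c n \<le> 1/2" "summable c"
    and step: "\<And>n. G (Suc n) \<le> G n - R n + c n * G (Suc n)"
  shows "convergent G" "summable R"
proof -
  have grow: "G (Suc n) \<le> G n * exp (2 * c n)" for n
  proof -
    have "G (Suc n) * (1 - c n) \<le> G n"
      using step[of n] R[of n] by (simp add: algebra_simps)
    \<comment> \<open>The product is \<open>1 + c n * (1 - 2 * c n)\<close>; here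
      \<open>c n \<le> 1/2\<close> enters.\<close>
    moreover have "1 \<le> (1 - c n) * (1 + 2 * c n)"
      using mult_nonneg_nonneg[of "c n" "1 - 2 * c n"] c(1,2)[of n] by (simp add: algebra_simps)
    ultimately have "G (Suc n) * 1 \<le> G (Suc n) * ((1 - c n) * (1 + 2 * c n))"
      and "G (Suc n) * (1 - c n) * (1 + 2 * c n) \<le> G n * (1 + 2 * c n)"
      using mult_left_mono[of 1 "(1 - c n) * (1 + 2 * c n)" "G (Suc n)"]
        mult_right_mono[of "G (Suc n) * (1 - c n)" "G n" "1 + 2 * c n"] c(1)[of n] G[of "Suc n"]
      by linarith+
    then have "G (Suc n) \<le> G n * (1 + 2 * c n)" by (simp only: mult.assoc mult_1_right)
    also have "\<dots> \<le> G n * exp (2 * c n)"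
      using exp_ge_add_one_self[of "2 * c n"] G[of n] by (intro mult_left_mono) auto
    finally show ?thesis .
  qed
  have B1: "G n \<le> G 0 * exp (2 * sum c {..<n})" for n
  proof (induction n)
    case (Suc n)
    have "G (Suc n) \<le> G 0 * exp (2 * sum c {..<n}) * exp (2 * c n)"
      using grow[of n] mult_right_mono[OF Suc, of "exp (2 * c n)"] exp_ge_zero[of "2 * c n"]
      by linarith
    then show ?case by (simp add: exp_add[symmetric] mult.assoc distrib_left)
  qed simp
  have csum: "sum c {..<n} \<le> suminf c" for n
    using c by (intro sum_le_suminf) auto
  have "G 0 * exp (2 * sum c {..<n}) \<le> G 0 * exp (2 * suminf c)" for n
    using csum[of n] G[of 0] by (intro mult_left_mono) auto
  with B1 have bd: "G n \<le> G 0 * exp (2 * suminf c)" (is "_ \<le> ?B") for n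
    using order_trans by blast
  have B: "0 \<le> ?B" using G[of 0] by simp
  \<comment> \<open>Subtracting a bound on the accumulated errors turns the perturbed descent into a
    genuine one.\<close>
  define W where "W n = G n - ?B * sum c {..<n}" for n
  have W: "W (Suc n) \<le> W n - R n" for n
    using step[of n] mult_left_mono[OF bd[of "Suc n"] c(1)[of n]]
    by (simp add: W_def algebra_simps)
  have lo: "- (?B * suminf c) \<le> W n" for n
    using mult_left_mono[OF csum[of n] B] G[of n] by (simp add: W_def)
  have "decseq W" unfolding decseq_Suc_iff
  proof
    fix n show "W (Suc n) \<le> W n" using W[of n] R[of n] by linarith
  qed
  then obtain l where l: "W \<longlonglongrightarrow> l" using decseq_convergent[of W] lo by blast
  have "(\<lambda>n. W n + ?B * sum c {..<n}) \<longlonglongrightarrow> l + ?B * suminf c"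
    by (intro tendsto_intros l summable_LIMSEQ c)
  then show "convergent G" unfolding W_def by (auto simp: convergent_def)
  have "sum R {..<n} \<le> W 0 - W n" for n
  proof (induction n)
    case (Suc n) then show ?case using W[of n] by simp
  qed simp
  then have "sum R {..<n} \<le> W 0 + ?B * suminf c" for n
    by (rule order_trans) (use lo[of n] in linarith)
  then show "summable R" using R by (intro summableI_nonneg_bounded) auto
qed

text \<open>A positive limit would make \<open>H n / n\<close> eventually dominate a multiple of the
  harmonic series.\<close>

lemma tendsto_zero_if_harmonic_summable:
  fixes H :: "nat \<Rightarrow> real"
  assumes H: "\<And>n. 2 \<le> n \<Longrightarrow> 0 \<le> H n" and "H \<longlonglongrightarrow> l" and sum: "summable (\<lambda>n. H n / real n)"
  shows "H \<longlonglongrightarrow> 0"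
proof -
  have "0 \<le> l" using assms(2) H by (intro LIMSEQ_le_const[of H l 0]) blast+
  have "l = 0"
  proof (rule ccontr)
    assume "l \<noteq> 0"
    then have "l > 0" using \<open>0 \<le> l\<close> by simp
    then have "eventually (\<lambda>n. H n > l / 2) sequentially"
      using assms(2) by (intro order_tendstoD(1)) auto
    then have "eventually (\<lambda>n. norm (inverse (real n)) \<le> (2 / l) * (H n / real n)) sequentially"
      using eventually_ge_at_top[of 2]
    proof eventually_elim
      case (elim n)
      then show ?case using \<open>l > 0\<close> by (simp add: field_simps)
    qed
    then have "summable (\<lambda>n. inverse (real n))"
      by (rule summable_comparison_test_ev) (intro summable_mult sum)
    then show False using not_summable_harmonic[where 'a=real] by simp
  qed
  then show ?thesis using assms(2) by simp
qed

section \<open>One-step estimate for the energy\<close>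

lemma young:
  fixes a b m :: real
  assumes "0 < m"
  shows "a * b \<le> m * b\<^sup>2 + a\<^sup>2 / (4 * m)"
proof -
  have "0 \<le> m * (b - a / (2 * m))\<^sup>2" using assms by simp
  also have "\<dots> = m * b\<^sup>2 + a\<^sup>2 / (4 * m) - a * b"
    using assms by (simp add: power2_eq_square field_simps)
  finally show ?thesis by simp
qed

text \<open>
  The exact one-step change of the energy. The factor \<open>D - e' + e\<close> is the increment of the
  monotone operator, so its inner product with \<open>d\<close> is nonnegative; \<open>r\<close> stands for the norm of
  the previous increment of \<open>V\<close>.
\<close>

definition energy_drift ::
  "real \<Rightarrow> real \<Rightarrow> real \<Rightarrow> 'a::real_inner \<Rightarrow> 'a \<Rightarrow> 'a \<Rightarrow> 'a \<Rightarrow> 'a \<Rightarrow> 'a \<Rightarrow> real \<Rightarrow> real" where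
  "energy_drift \<alpha> \<kappa> k x d V D e e' r =
     - \<kappa> * (\<alpha> - 2) * inner x V + \<kappa> * (k + (\<alpha> + 1) / 2) * (norm d)\<^sup>2 + \<kappa> * (2 * k + \<alpha>) * inner d V
     - (\<alpha> - 1) * (2 * k + 1 + \<alpha>) / 2 * (norm (d + V))\<^sup>2 + (2 * k + 1) / 2 * (norm V)\<^sup>2
     - k * (k + \<alpha>) * inner d (D - e' + e) - \<alpha> * k * inner V D - k\<^sup>2 * (norm D)\<^sup>2
     + ((2 - \<alpha>) * k + 1) * inner d e' - \<alpha> * k * inner V e - 2 * k\<^sup>2 * inner D e
     + (k + 1)\<^sup>2 / 2 * (norm D)\<^sup>2 - k\<^sup>2 / 2 * r\<^sup>2"

text \<open>With \<open>x\<close>, \<open>d\<close>, \<open>V\<close>, \<open>D\<close>,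
  \<open>e'\<close> taken at index \<open>k + 1\<close>, the vectors \<open>x - d\<close> and
  \<open>V - D\<close> are the error and the value of \<open>V\<close> at index \<open>k\<close>,
  and \<open>K\<close> is \<open>k\<close> times the previous displacement. Once the recursion has
  eliminated \<open>K\<close>, both sides are the same quadratic polynomial.\<close>

lemma energy_drift_eq:
  fixes x d V D e e' K :: "'a::real_inner" and k \<alpha> \<kappa> r :: real
  assumes K: "(k + \<alpha>) *\<^sub>R d = K - \<alpha> *\<^sub>R V - (2 * k) *\<^sub>R D"
  shows "(\<kappa> * ((\<alpha> - 1) / 2 * (norm x)\<^sup>2 + inner x ((k + 1) *\<^sub>R d + (2 * (k + 1)) *\<^sub>R V))
     + (norm ((k + 1) *\<^sub>R d + (k + 1) *\<^sub>R V))\<^sup>2 / 2 + (norm ((k + 1) *\<^sub>R V))\<^sup>2 / 2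
     + (k + 1) * inner ((k + 1) *\<^sub>R d) e' + ((k + 1) * norm D)\<^sup>2 / 2)
   - (\<kappa> * ((\<alpha> - 1) / 2 * (norm (x - d))\<^sup>2 + inner (x - d) (K + (2 * k) *\<^sub>R (V - D)))
     + (norm (K + k *\<^sub>R (V - D)))\<^sup>2 / 2 + (norm (k *\<^sub>R (V - D)))\<^sup>2 / 2
     + k * inner K e + (k * r)\<^sup>2 / 2)
   = energy_drift \<alpha> \<kappa> k x d V D e e' r"
proof -
  have K: "K = (k + \<alpha>) *\<^sub>R d + \<alpha> *\<^sub>R V + (2 * k) *\<^sub>R D" using K by simp
  show ?thesis unfolding K energy_drift_def power2_norm_eq_inner power_mult_distrib
    by (simp add: inner_simps inner_commute power2_eq_square field_simps)
qed

text \<open>For large \<open>k\<close> each term is charged either to the negative definite form of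
  order \<open>k\<close> in \<open>d\<close> and \<open>V\<close> or to the negative multiples of
  \<open>(k |D|)^2\<close> and \<open>(k r)^2\<close>. Only the term with \<open>inner x V\<close>
  leaves a remainder, \<open>C / k^2 |x|^2\<close>, whose coefficient is summable.\<close>

lemma energy_drift_le:
  fixes \<alpha> \<theta> \<kappa> :: real
  assumes \<theta>: "0 \<le> \<theta>" "\<theta> < 1/2" and \<kappa>: "1 < \<kappa>" "\<kappa> < \<alpha> - 1"
  obtains c C N :: real where "0 < c" "0 \<le> C" "1 \<le> N"
    "\<And>k r x d V D e e'. \<lbrakk>N \<le> k; norm (e' :: 'a::real_inner) \<le> \<theta> * norm D; norm e \<le> \<theta> * r;
       0 \<le> inner d (D - e' + e); - (\<theta> * norm D) * norm x \<le> inner x V\<rbrakk> \<Longrightarrow>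
     energy_drift \<alpha> \<kappa> k x d V D e e' r
     \<le> - c * (k * (norm d)\<^sup>2 + k * (norm V)\<^sup>2 + k\<^sup>2 * (norm D)\<^sup>2) + C / k\<^sup>2 * (norm x)\<^sup>2"
proof -
  \<comment> \<open>\<eta> is the margin left in front of \<open>(k |D|)^2\<close> and
    \<open>(k r)^2\<close> after the term with \<open>inner D e\<close>; each further use spends
    \<eta>/8. \<open>m\<close> is the smaller coefficient of the form of order \<open>k\<close>.
    \<open>C1\<close> collects the coefficients of order 1 of \<open>|d|^2\<close> and
    \<open>|V|^2\<close>, and \<open>C\<close> is what Young's inequality leaves on
    \<open>|x|^2\<close>.\<close>
  define \<eta> where "\<eta> = 1/2 - \<theta>"
  define m where "m = min (\<alpha> - 1 - \<kappa>) (\<kappa> - 1)"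
  define C1 where "C1 = \<kappa> * (\<alpha> + 1) / 2 + \<kappa> * \<alpha> + 1 / 2 + 4 / \<eta> * \<alpha>\<^sup>2"
  define C where "C = 2 / \<eta> * (\<kappa> * (\<alpha> - 2))\<^sup>2"
  \<comment> \<open>\<open>16 / \<eta>\<close> makes \<open>k + 1/2 \<le> \<eta> k^2 / 8\<close>,
    for \<open>b7\<close>; \<open>6 * C1 / m\<close> lets half of the form of order \<open>k\<close>
    absorb \<open>C1\<close>, for \<open>b11\<close>.\<close>
  define N where "N = max 1 (max (16 / \<eta>) (6 * C1 / m))"
  have \<eta>: "0 < \<eta>" and m: "0 < m" and \<alpha>: "2 < \<alpha>" and C: "0 \<le> C"
    using assms by (auto simp: \<eta>_def m_def C_def)
  have main: "energy_drift \<alpha> \<kappa> k x d V D e e' r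
     \<le> - min (m / 6) (\<eta> / 2) * (k * (norm d)\<^sup>2 + k * (norm V)\<^sup>2 + k\<^sup>2 * (norm D)\<^sup>2)
       + C / k\<^sup>2 * (norm x)\<^sup>2"
    if k: "N \<le> k" and e': "norm e' \<le> \<theta> * norm D" and e: "norm e \<le> \<theta> * r"
      and mono: "0 \<le> inner d (D - e' + e)" and sol: "- (\<theta> * norm D) * norm x \<le> inner x V"
    for k r :: real and x d V D e e' :: 'a
  proof -
    have k1: "1 \<le> k" and k2: "16 \<le> \<eta> * k" and k3: "6 * C1 \<le> k * m"
      using k \<eta> m by (auto simp: N_def field_simps)
    let ?\<delta> = "norm d" and ?v = "norm V" and ?t = "norm D" and ?X = "norm x"
    have r: "norm e \<le> \<bar>r\<bar>"
      using e \<theta> mult_right_mono[of \<theta> 1 "\<bar>r\<bar>"] mult_left_mono[of r "\<bar>r\<bar>" \<theta>] by linarith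
    have t: "norm e' \<le> ?t" using e' \<theta> mult_right_mono[of \<theta> 1 ?t] by auto
    have b1: "- \<kappa> * (\<alpha> - 2) * inner x V \<le> \<eta> / 8 * (k * ?t)\<^sup>2 + C / k\<^sup>2 * ?X\<^sup>2"
    proof -
      have "- ?X * ?t \<le> inner x V"
        using sol \<theta> mult_right_mono[of \<theta> 1 "?t * ?X"] by (simp add: ac_simps)
      then have "\<kappa> * (\<alpha> - 2) * - inner x V \<le> \<kappa> * (\<alpha> - 2) * (?X * ?t)"
        using \<alpha> \<kappa> by (intro mult_left_mono) auto
      also have "\<dots> = (\<kappa> * (\<alpha> - 2) * ?X / k) * (k * ?t)" using k1 by simp
      also have "\<dots> \<le> \<eta> / 8 * (k * ?t)\<^sup>2 + (\<kappa> * (\<alpha> - 2) * ?X / k)\<^sup>2 / (4 * (\<eta> / 8))"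
        using \<eta> by (intro young) auto
      also have "(\<kappa> * (\<alpha> - 2) * ?X / k)\<^sup>2 / (4 * (\<eta> / 8)) = C / k\<^sup>2 * ?X\<^sup>2"
        using \<eta> by (simp add: C_def power_divide power_mult_distrib mult_ac)
      finally show ?thesis by simp
    qed
    have b2: "\<kappa> * \<alpha> * inner d V \<le> \<kappa> * \<alpha> * (?\<delta>\<^sup>2 + ?v\<^sup>2)"
    proof (intro mult_left_mono)
      have "0 \<le> ?\<delta> * ?v" by simp
      then show "inner d V \<le> ?\<delta>\<^sup>2 + ?v\<^sup>2"
        using norm_cauchy_schwarz[of d V] sum_squares_bound[of ?\<delta> ?v] by linarith
    qed (use \<alpha> \<kappa> in auto)
    \<comment> \<open>Inner products with a coefficient of order \<open>k\<close> pair
      \<open>k s\<close> with a factor of order 1, so Young's inequality leaves only a constant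
      multiple of \<open>|f|^2\<close>.\<close>
    have cross: "a * inner f g \<le> \<eta> / 8 * (k * s)\<^sup>2 + 2 / \<eta> * \<alpha>\<^sup>2 * (norm f)\<^sup>2"
      if "\<bar>a\<bar> \<le> \<alpha> * k" "norm g \<le> \<bar>s\<bar>" for a s and f g :: 'a
    proof -
      have "a * inner f g \<le> \<bar>a\<bar> * \<bar>inner f g\<bar>" by (metis abs_ge_self abs_mult)
      also have "\<dots> \<le> (\<alpha> * k) * (norm f * \<bar>s\<bar>)"
        using that Cauchy_Schwarz_ineq2[of f g] mult_left_mono[OF that(2), of "norm f"] \<alpha> k1
        by (intro mult_mono) auto
      also have "\<dots> = (\<alpha> * norm f) * (k * \<bar>s\<bar>)" by simp
      also have "\<dots> \<le> \<eta> / 8 * (k * \<bar>s\<bar>)\<^sup>2 + (\<alpha> * norm f)\<^sup>2 / (4 * (\<eta> / 8))"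
        using \<eta> by (intro young) auto
      finally show ?thesis using \<eta> by (simp add: power_mult_distrib field_simps)
    qed
    have b3: "- \<alpha> * k * inner V D \<le> \<eta> / 8 * (k * ?t)\<^sup>2 + 2 / \<eta> * \<alpha>\<^sup>2 * ?v\<^sup>2"
      using \<alpha> k1 by (intro cross) (auto simp: abs_mult)
    have "2 * k \<le> \<alpha> * k" using \<alpha> k1 by (intro mult_right_mono) auto
    then have "\<bar>(2 - \<alpha>) * k + 1\<bar> \<le> \<alpha> * k"
      using k1 unfolding abs_le_iff left_diff_distrib by linarith
    then have b4: "((2 - \<alpha>) * k + 1) * inner d e' \<le> \<eta> / 8 * (k * ?t)\<^sup>2 + 2 / \<eta> * \<alpha>\<^sup>2 * ?\<delta>\<^sup>2"
      using t by (intro cross) auto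
    have b5: "- \<alpha> * k * inner V e \<le> \<eta> / 8 * (k * r)\<^sup>2 + 2 / \<eta> * \<alpha>\<^sup>2 * ?v\<^sup>2"
      using \<alpha> k1 r by (intro cross) (auto simp: abs_mult)
    \<comment> \<open>This mixed term has the full order \<open>k^2\<close>; \<theta> < 1/2 is what
      keeps it below the available \<open>(k |D|)^2 / 2 + (k r)^2 / 2\<close>.\<close>
    have b6: "- 2 * k\<^sup>2 * inner D e \<le> \<theta> * k\<^sup>2 * (?t\<^sup>2 + r\<^sup>2)"
    proof -
      have "- inner D e \<le> ?t * (\<theta> * r)"
        using Cauchy_Schwarz_ineq2[of D e] mult_left_mono[OF e, of ?t] by auto
      then have "2 * k\<^sup>2 * - inner D e \<le> 2 * k\<^sup>2 * (?t * (\<theta> * r))"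
        by (intro mult_left_mono) auto
      also have "\<dots> = \<theta> * k\<^sup>2 * (2 * ?t * r)" by simp
      also have "\<dots> \<le> \<theta> * k\<^sup>2 * (?t\<^sup>2 + r\<^sup>2)"
        using \<theta> by (intro mult_left_mono sum_squares_bound) auto
      finally show ?thesis by simp
    qed
    have b7: "(k + 1)\<^sup>2 / 2 * ?t\<^sup>2 - k\<^sup>2 * ?t\<^sup>2 \<le> (\<eta> / 8 - 1 / 2) * (k * ?t)\<^sup>2"
    proof -
      have "16 * k \<le> \<eta> * k * k" using mult_right_mono[OF k2, of k] k1 by simp
      moreover have "(\<eta> / 8 - 1 / 2) * k\<^sup>2 = \<eta> * k * k / 8 - k * k / 2"
        "(k + 1)\<^sup>2 / 2 - k\<^sup>2 = 1 / 2 + k - k * k / 2"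
        by (simp_all add: power2_eq_square field_simps)
      ultimately have "(k + 1)\<^sup>2 / 2 - k\<^sup>2 \<le> (\<eta> / 8 - 1 / 2) * k\<^sup>2"
        using k1 by linarith
      from mult_right_mono[OF this, of "?t\<^sup>2"] show ?thesis
        by (simp add: power_mult_distrib algebra_simps)
    qed
    \<comment> \<open>The part of order \<open>k\<close> is \<open>-(\<alpha> - 1 - \<kappa>) |d + V|^2 - (\<kappa> - 1) |V|^2\<close>.\<close>
    have b8: "\<kappa> * ?\<delta>\<^sup>2 + 2 * \<kappa> * inner d V - (\<alpha> - 1) * (norm (d + V))\<^sup>2 + ?v\<^sup>2
      \<le> - (m / 3) * (?\<delta>\<^sup>2 + ?v\<^sup>2)"
    proof -
      have dv: "(norm (d + V))\<^sup>2 = ?\<delta>\<^sup>2 + 2 * inner d V + ?v\<^sup>2"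
        by (simp add: power2_norm_eq_inner inner_simps inner_commute)
      \<comment> \<open>\<open>3 (|d + V|^2 + |V|^2) - |d|^2 - |V|^2\<close> equals
        \<open>|2 d + 3 V|^2 / 2 + |V|^2 / 2\<close>.\<close>
      have "(norm (2 *\<^sub>R d + 3 *\<^sub>R V))\<^sup>2 = 4 * ?\<delta>\<^sup>2 + 12 * inner d V + 9 * ?v\<^sup>2"
        by (simp add: power2_norm_eq_inner inner_simps inner_commute)
      then have "0 \<le> 4 * ?\<delta>\<^sup>2 + 12 * inner d V + 9 * ?v\<^sup>2" by (metis zero_le_power2)
      moreover have "0 \<le> ?v\<^sup>2" by simp
      ultimately have "?\<delta>\<^sup>2 + ?v\<^sup>2 \<le> 3 * (?\<delta>\<^sup>2 + 2 * inner d V + ?v\<^sup>2 + ?v\<^sup>2)"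
        by argo
      then have "?\<delta>\<^sup>2 + ?v\<^sup>2 \<le> 3 * ((norm (d + V))\<^sup>2 + ?v\<^sup>2)" unfolding dv .
      then have "m * (?\<delta>\<^sup>2 + ?v\<^sup>2) \<le> m * (3 * ((norm (d + V))\<^sup>2 + ?v\<^sup>2))"
        using m by (intro mult_left_mono) auto
      moreover have "m * (norm (d + V))\<^sup>2 \<le> (\<alpha> - 1 - \<kappa>) * (norm (d + V))\<^sup>2"
        and "m * ?v\<^sup>2 \<le> (\<kappa> - 1) * ?v\<^sup>2"
        by (auto intro!: mult_right_mono simp: m_def)
      ultimately show ?thesis unfolding dv by (simp add: algebra_simps)
    qed
    have b9: "- (k * (k + \<alpha>)) * inner d (D - e' + e) \<le> 0"
      using mono \<alpha> k1 by (simp add: mult_nonneg_nonneg)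
    have b10: "- (\<alpha> - 1) * (1 + \<alpha>) / 2 * (norm (d + V))\<^sup>2 \<le> 0"
      using \<alpha> by (auto intro!: mult_nonpos_nonneg)
    have b11: "C1 * (?\<delta>\<^sup>2 + ?v\<^sup>2) \<le> m / 6 * (k * (?\<delta>\<^sup>2 + ?v\<^sup>2))"
      using mult_right_mono[of C1 "m / 6 * k" "?\<delta>\<^sup>2 + ?v\<^sup>2"] k3
      by (simp add: mult_ac add_nonneg_nonneg)
    have b12: "k * (\<kappa> * ?\<delta>\<^sup>2 + 2 * \<kappa> * inner d V - (\<alpha> - 1) * (norm (d + V))\<^sup>2 + ?v\<^sup>2)
      \<le> k * (- (m / 3) * (?\<delta>\<^sup>2 + ?v\<^sup>2))"
      using b8 k1 by (intro mult_left_mono) auto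
    have b13: "min (m / 6) (\<eta> / 2) * (k * (?\<delta>\<^sup>2 + ?v\<^sup>2)) \<le> m / 6 * (k * (?\<delta>\<^sup>2 + ?v\<^sup>2))"
      "min (m / 6) (\<eta> / 2) * (k * ?t)\<^sup>2 \<le> \<eta> / 2 * (k * ?t)\<^sup>2"
      by (rule mult_right_mono; use k1 in simp)+
    have b14: "0 \<le> \<kappa> * (\<alpha> + 1) / 2 * ?v\<^sup>2" "0 \<le> ?\<delta>\<^sup>2" "0 \<le> 2 / \<eta> * \<alpha>\<^sup>2 * ?\<delta>\<^sup>2" "0 \<le> \<eta> * (k * r)\<^sup>2"
      using \<alpha> \<kappa> \<eta> by auto
    have \<theta>\<eta>: "\<theta> = 1 / 2 - \<eta>" by (simp add: \<eta>_def)
    have c1: "C1 * (?\<delta>\<^sup>2 + ?v\<^sup>2) = \<kappa> * (\<alpha> + 1) / 2 * ?\<delta>\<^sup>2 + \<kappa> * (\<alpha> + 1) / 2 * ?v\<^sup>2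
      + \<kappa> * \<alpha> * (?\<delta>\<^sup>2 + ?v\<^sup>2) + ?\<delta>\<^sup>2 / 2 + ?v\<^sup>2 / 2
      + 2 * (2 / \<eta> * \<alpha>\<^sup>2 * ?\<delta>\<^sup>2) + 2 * (2 / \<eta> * \<alpha>\<^sup>2 * ?v\<^sup>2)"
      by (simp add: C1_def algebra_simps add_divide_distrib)
    have c2: "\<theta> * k\<^sup>2 * (?t\<^sup>2 + r\<^sup>2) = (k * ?t)\<^sup>2 / 2 + (k * r)\<^sup>2 / 2 - \<eta> * (k * ?t)\<^sup>2 - \<eta> * (k * r)\<^sup>2"
      by (simp add: \<theta>\<eta> algebra_simps power_mult_distrib)
    have eq: "energy_drift \<alpha> \<kappa> k x d V D e e' r
     = - \<kappa> * (\<alpha> - 2) * inner x V + \<kappa> * (\<alpha> + 1) / 2 * ?\<delta>\<^sup>2 + \<kappa> * \<alpha> * inner d V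
       + - (\<alpha> - 1) * (1 + \<alpha>) / 2 * (norm (d + V))\<^sup>2 + ?v\<^sup>2 / 2
       + - (k * (k + \<alpha>)) * inner d (D - e' + e) + - \<alpha> * k * inner V D
       + ((2 - \<alpha>) * k + 1) * inner d e' + - \<alpha> * k * inner V e + - 2 * k\<^sup>2 * inner D e
       + ((k + 1)\<^sup>2 / 2 * ?t\<^sup>2 - k\<^sup>2 * ?t\<^sup>2) - (k * r)\<^sup>2 / 2
       + k * (\<kappa> * ?\<delta>\<^sup>2 + 2 * \<kappa> * inner d V - (\<alpha> - 1) * (norm (d + V))\<^sup>2 + ?v\<^sup>2)"
      unfolding energy_drift_def
      by (simp add: algebra_simps power_mult_distrib add_divide_distrib diff_divide_distrib)
    have eq2: "- min (m / 6) (\<eta> / 2) * (k * (norm d)\<^sup>2 + k * (norm V)\<^sup>2 + k\<^sup>2 * (norm D)\<^sup>2)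
      = - (min (m / 6) (\<eta> / 2) * (k * (?\<delta>\<^sup>2 + ?v\<^sup>2))) - min (m / 6) (\<eta> / 2) * (k * ?t)\<^sup>2"
      by (simp add: algebra_simps power_mult_distrib)
    have b12': "k * (\<kappa> * ?\<delta>\<^sup>2 + 2 * \<kappa> * inner d V - (\<alpha> - 1) * (norm (d + V))\<^sup>2 + ?v\<^sup>2)
      \<le> - 2 * (m / 6 * (k * (?\<delta>\<^sup>2 + ?v\<^sup>2)))" using b12 by (simp add: field_simps)
    have b7': "(k + 1)\<^sup>2 / 2 * ?t\<^sup>2 - k\<^sup>2 * ?t\<^sup>2 \<le> \<eta> / 8 * (k * ?t)\<^sup>2 - (k * ?t)\<^sup>2 / 2"
      using b7 by (simp add: algebra_simps)
    have e1: "\<eta> / 8 * (k * ?t)\<^sup>2 = \<eta> * (k * ?t)\<^sup>2 / 8" "\<eta> / 2 * (k * ?t)\<^sup>2 = \<eta> * (k * ?t)\<^sup>2 / 2"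
      "\<eta> / 8 * (k * r)\<^sup>2 = \<eta> * (k * r)\<^sup>2 / 8" by auto
    show ?thesis
      unfolding eq eq2
      using b1 b2 b3 b4 b5 b6 b7' b9 b10 b11 b12' b13 b14 unfolding c1 c2 e1 by linarith
  qed
  show thesis
    by (rule that[of "min (m / 6) (\<eta> / 2)" C N]) (use \<eta> m C main in \<open>auto simp: N_def\<close>)
qed

section \<open>The recursion in abstract form\<close>

text \<open>The operator enters only through its values \<open>V k - e k\<close> at the iterates:
  they are monotone along the sequence and satisfy the solution inequality at \<open>zs\<close>. As
  \<open>err\<close> first controls \<open>e 2\<close>, estimates involving \<open>e k\<close> start
  at \<open>k = 2\<close>.\<close>

locale inertial_recursion =
  fixes z V e :: "nat \<Rightarrow> 'a::real_inner" and zs :: 'a and \<alpha> \<theta> :: real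
  assumes \<alpha>: "2 < \<alpha>" and \<theta>: "0 \<le> \<theta>" "\<theta> < 1/2"
    and rec: "\<And>k. 1 \<le> k \<Longrightarrow> (real k + \<alpha>) *\<^sub>R (z (Suc k) - z k) =
       real k *\<^sub>R (z k - z (k - 1)) - \<alpha> *\<^sub>R V (Suc k) - (2 * real k) *\<^sub>R (V (Suc k) - V k)"
    and err: "\<And>k. 1 \<le> k \<Longrightarrow> norm (e (Suc k)) \<le> \<theta> * norm (V (Suc k) - V k)"
    and mono: "\<And>k. 1 \<le> k \<Longrightarrow>
       0 \<le> inner (z (Suc k) - z k) ((V (Suc k) - e (Suc k)) - (V k - e k))"
    and sol: "\<And>k. 1 \<le> k \<Longrightarrow> 0 \<le> inner (z k - zs) (V k - e k)"
begin

definition d :: "nat \<Rightarrow> 'a" where "d k = z k - z (k - 1)"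
definition D :: "nat \<Rightarrow> 'a" where "D k = V k - V (k - 1)"

definition p :: "nat \<Rightarrow> real" where
  "p k = (\<alpha> - 1) / 2 * (norm (z k - zs))\<^sup>2 + inner (z k - zs) (real k *\<^sub>R d k + (2 * real k) *\<^sub>R V k)"

definition H :: "nat \<Rightarrow> real" where
  "H k = (norm (real k *\<^sub>R d k + real k *\<^sub>R V k))\<^sup>2 / 2 + (norm (real k *\<^sub>R V k))\<^sup>2 / 2
     + real k * inner (real k *\<^sub>R d k) (e k) + (real k * norm (D k))\<^sup>2 / 2"

section \<open>Bounds for the energy from both sides\<close>

lemma norm_err_le: "2 \<le> k \<Longrightarrow> norm (e k) \<le> \<theta> * norm (D k)"
  using err[of "k - 1"] by (simp add: D_def)

text \<open>Completing squares leaves only terms of known sign, apart from the error term.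
  \<open>V k\<close> is paired with \<open>- e k\<close> because only the difference has a sign
  against \<open>z k - zs\<close>. The case \<kappa> = 0 describes \<open>H\<close> alone.\<close>

lemma energy_eq:
  assumes "2 \<le> k"
  shows "\<kappa> * p k + H k = (norm (\<kappa> *\<^sub>R (z k - zs) + real k *\<^sub>R d k))\<^sup>2 / 4
    + (norm (\<kappa> *\<^sub>R (z k - zs) + real k *\<^sub>R d k + (2 * real k) *\<^sub>R V k))\<^sup>2 / 4
    + \<kappa> * (\<alpha> - 1 - \<kappa>) / 2 * (norm (z k - zs))\<^sup>2 + \<kappa> * real k * inner (z k - zs) (V k - e k)
    + real k * inner (\<kappa> *\<^sub>R (z k - zs) + real k *\<^sub>R d k) (e k) + (real k * norm (D k))\<^sup>2 / 2"
  unfolding p_def H_def power2_norm_eq_inner power_mult_distrib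
  by (simp add: inner_add_left inner_add_right inner_diff_right inner_diff_left inner_commute
      power2_eq_square field_simps)

lemma inner_err_lower:
  assumes "2 \<le> k"
  shows "- (norm y * (real k * norm (D k)) / 2) \<le> real k * inner y (e k)"
proof -
  have "norm (e k) \<le> norm (D k) / 2"
    using norm_err_le[OF assms] \<theta> mult_right_mono[of \<theta> "1/2" "norm (D k)"] by simp
  then have "norm y * norm (e k) \<le> norm y * (norm (D k) / 2)"
    by (intro mult_left_mono) auto
  then have "- inner y (e k) \<le> norm y * (norm (D k) / 2)"
    using Cauchy_Schwarz_ineq2[of y "e k"] by linarith
  from mult_left_mono[OF this, of "real k"] show ?thesis by (simp add: algebra_simps)
qed

text \<open>The error term is at most \<open>|y| s / 2\<close> in size and is absorbed by the
  squares \<open>|y|^2 / 4\<close> and \<open>s^2 / 2\<close> in \<open>energy_eq\<close>. For 0 <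
  \<kappa> < \<alpha> - 1 the energy therefore controls the distance to \<open>zs\<close>.\<close>

lemma energy_ge:
  assumes k: "2 \<le> k" and \<kappa>: "0 \<le> \<kappa>"
  shows "\<kappa> * (\<alpha> - 1 - \<kappa>) / 2 * (norm (z k - zs))\<^sup>2 \<le> \<kappa> * p k + H k"
proof -
  let ?y = "\<kappa> *\<^sub>R (z k - zs) + real k *\<^sub>R d k" and ?s = "real k * norm (D k)"
  have "0 \<le> \<kappa> * real k * inner (z k - zs) (V k - e k)"
    using sol[of k] k \<kappa> by auto
  moreover have "norm ?y * ?s / 2 \<le> (norm ?y)\<^sup>2 / 4 + ?s\<^sup>2 / 2"
    using sum_squares_bound[of "norm ?y" ?s] zero_le_power2[of ?s]
    by (simp only: mult.assoc)
  ultimately show ?thesis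
    using inner_err_lower[OF k, of ?y]
      zero_le_power2[of "norm (?y + (2 * real k) *\<^sub>R V k)"]
    unfolding energy_eq[OF k] by linarith
qed

lemma H_ge:
  assumes k: "2 \<le> k"
  shows "(real k * norm (V k))\<^sup>2 / 4 \<le> H k"
proof -
  let ?y = "real k *\<^sub>R d k" and ?s = "real k * norm (D k)" and ?u = "real k *\<^sub>R V k"
  have eq: "H k = (norm ?y)\<^sup>2 / 4 + (norm (?y + 2 *\<^sub>R ?u))\<^sup>2 / 4 + real k * inner ?y (e k) + ?s\<^sup>2 / 2"
    using energy_eq[OF k, of 0] by simp
  \<comment> \<open>The weight spends all of \<open>?s^2 / 2\<close> but only half of
    \<open>|?y|^2 / 4\<close>; the other half is used to isolate \<open>?u\<close>.\<close>
  have "norm ?y * ?s / 2 \<le> (norm ?y)\<^sup>2 / 8 + ?s\<^sup>2 / 2"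
    using young[of "1/2" "norm ?y / 2" ?s] by (simp add: power_divide)
  then have "(norm ?y)\<^sup>2 / 8 + (norm (?y + 2 *\<^sub>R ?u))\<^sup>2 / 4 \<le> H k"
    using inner_err_lower[OF k, of ?y] unfolding eq by linarith
  moreover have "(norm u)\<^sup>2 / 4 \<le> (norm y)\<^sup>2 / 8 + (norm (y + 2 *\<^sub>R u))\<^sup>2 / 4" for y u :: 'a
  proof -
    \<comment> \<open>The right side minus the left side is
      \<open>|3 y + 4 u|^2 / 24 + |u|^2 / 12\<close>.\<close>
    have "(norm (3 *\<^sub>R y + 4 *\<^sub>R u))\<^sup>2 = 9 * (norm y)\<^sup>2 + 24 * inner y u + 16 * (norm u)\<^sup>2"
      "(norm (y + 2 *\<^sub>R u))\<^sup>2 = (norm y)\<^sup>2 + 4 * inner y u + 4 * (norm u)\<^sup>2"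
      unfolding power2_norm_eq_inner by (simp_all add: inner_add_left inner_add_right inner_commute[of u y])
    moreover have "0 \<le> (norm (3 *\<^sub>R y + 4 *\<^sub>R u))\<^sup>2" "0 \<le> (norm u)\<^sup>2" by auto
    ultimately show ?thesis by linarith
  qed
  ultimately have "(norm ?u)\<^sup>2 / 4 \<le> H k" by (meson order_trans)
  then show ?thesis by simp
qed

text \<open>This makes \<open>H k / k\<close> comparable with the dissipation \<open>R\<close>, from
  which the summability of \<open>H k / k\<close> follows.\<close>

lemma H_le:
  assumes k: "2 \<le> k"
  shows "H k \<le> 2 * (real k)\<^sup>2 * ((norm (d k))\<^sup>2 + (norm (V k))\<^sup>2 + (norm (D k))\<^sup>2)"
proof -
  let ?d = "norm (d k)" and ?V = "norm (V k)" and ?D = "norm (D k)"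
  have H: "H k = (real k)\<^sup>2 * ((norm (d k + V k))\<^sup>2 / 2 + ?V\<^sup>2 / 2 + inner (d k) (e k) + ?D\<^sup>2 / 2)"
    unfolding H_def scaleR_add_right[symmetric] norm_scaleR power_mult_distrib
    by (simp add: power2_eq_square distrib_left)
  have "0 \<le> (norm (d k - V k))\<^sup>2" by simp
  then have "(norm (d k + V k))\<^sup>2 / 2 \<le> ?d\<^sup>2 + ?V\<^sup>2"
    unfolding power2_norm_eq_inner by (simp add: inner_simps inner_commute)
  moreover have "inner (d k) (e k) \<le> ?d\<^sup>2 + ?D\<^sup>2"
  proof -
    have "norm (e k) \<le> ?D" using norm_err_le[OF k] \<theta> mult_right_mono[of \<theta> 1 ?D] by simp
    then have "inner (d k) (e k) \<le> ?d * ?D"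
      using norm_cauchy_schwarz[of "d k" "e k"] mult_left_mono[of "norm (e k)" ?D ?d] by simp
    moreover have "0 \<le> ?d * ?D" by simp
    ultimately show ?thesis using sum_squares_bound[of ?d ?D] by linarith
  qed
  ultimately have "(norm (d k + V k))\<^sup>2 / 2 + ?V\<^sup>2 / 2 + inner (d k) (e k) + ?D\<^sup>2 / 2
      \<le> 2 * (?d\<^sup>2 + ?V\<^sup>2 + ?D\<^sup>2)"
    using zero_le_power2[of ?d] zero_le_power2[of ?V] zero_le_power2[of ?D] by argo
  from mult_left_mono[OF this, of "(real k)\<^sup>2"] show ?thesis
    unfolding H by (simp add: mult.left_commute mult.assoc del: distrib_left_numeral)
qed

section \<open>Descent and convergence of the energy\<close>

definition R :: "nat \<Rightarrow> real" where
  "R k = real k * (norm (d (Suc k)))\<^sup>2 + real k * (norm (V (Suc k)))\<^sup>2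
     + (real k)\<^sup>2 * (norm (D (Suc k)))\<^sup>2"

lemma R_nonneg: "0 \<le> R k" by (simp add: R_def)

lemma energy_descent:
  assumes \<kappa>: "1 < \<kappa>" "\<kappa> < \<alpha> - 1"
  obtains c C N :: real where "0 < c" "0 \<le> C" "1 \<le> N"
    "\<And>k. N \<le> real k \<Longrightarrow> 2 \<le> k \<Longrightarrow> \<kappa> * p (Suc k) + H (Suc k)
       \<le> \<kappa> * p k + H k - c * R k + C / (real k)\<^sup>2 * (norm (z (Suc k) - zs))\<^sup>2"
proof -
  obtain c C N :: real where *: "0 < c" "0 \<le> C" "1 \<le> N" and
    bound: "\<And>k r x d V D e e'. \<lbrakk>N \<le> k; norm (e' :: 'a) \<le> \<theta> * norm D; norm e \<le> \<theta> * r;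
       0 \<le> inner d (D - e' + e); - (\<theta> * norm D) * norm x \<le> inner x V\<rbrakk> \<Longrightarrow>
     energy_drift \<alpha> \<kappa> k x d V D e e' r
     \<le> - c * (k * (norm d)\<^sup>2 + k * (norm V)\<^sup>2 + k\<^sup>2 * (norm D)\<^sup>2) + C / k\<^sup>2 * (norm x)\<^sup>2"
    using energy_drift_le[OF \<theta> \<kappa>, where 'a = 'a] by blast
  have "\<kappa> * p (Suc k) + H (Suc k)
       \<le> \<kappa> * p k + H k - c * R k + C / (real k)\<^sup>2 * (norm (z (Suc k) - zs))\<^sup>2"
    if k: "N \<le> real k" "2 \<le> k" for k
  proof -
    let ?x = "z (Suc k) - zs" and ?d = "d (Suc k)" and ?V = "V (Suc k)" and ?D = "D (Suc k)"
    have e': "norm (e (Suc k)) \<le> \<theta> * norm ?D" by (rule norm_err_le) (use k in auto)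
    have e: "norm (e k) \<le> \<theta> * norm (D k)" by (rule norm_err_le) (use k in auto)
    have m: "0 \<le> inner ?d (?D - e (Suc k) + e k)"
      using mono[of k] k by (simp add: d_def D_def algebra_simps)
    have "- (\<theta> * norm ?D) * norm ?x \<le> inner ?x (e (Suc k))"
    proof -
      have "\<bar>inner ?x (e (Suc k))\<bar> \<le> norm ?x * norm (e (Suc k))" by (rule Cauchy_Schwarz_ineq2)
      then show ?thesis
        using mult_right_mono[OF e', of "norm ?x"] by (simp add: mult.commute abs_le_iff)
    qed
    then have s: "- (\<theta> * norm ?D) * norm ?x \<le> inner ?x ?V"
      using sol[of "Suc k"] by (simp add: inner_diff_right)
    have K: "(real k + \<alpha>) *\<^sub>R ?d = real k *\<^sub>R d k - \<alpha> *\<^sub>R ?V - (2 * real k) *\<^sub>R ?D"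
      using rec[of k] k by (simp add: d_def D_def)
    have x: "?x - ?d = z k - zs" and V: "?V - ?D = V k" by (simp_all add: d_def D_def)
    have "\<kappa> * p (Suc k) + H (Suc k) - (\<kappa> * p k + H k)
      \<le> - c * (real k * (norm ?d)\<^sup>2 + real k * (norm ?V)\<^sup>2 + (real k)\<^sup>2 * (norm ?D)\<^sup>2)
        + C / (real k)\<^sup>2 * (norm ?x)\<^sup>2"
      using energy_drift_eq[OF K, of \<kappa> ?x "e (Suc k)" "e k" "norm (D k)"] bound[OF k(1) e' e m s]
      unfolding x V p_def H_def of_nat_Suc by (simp add: add.commute[of 1])
    then show ?thesis by (simp add: R_def)
  qed
  with * show thesis by (rule that)
qed

text \<open>By \<open>energy_ge\<close> the remainder \<open>C / k^2 |z (Suc k) - zs|^2\<close> is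
  at most \<open>B / k^2\<close> times the new energy, so it is a relative error with summable
  coefficients and \<open>perturbed_descent\<close> applies to a tail.\<close>

lemma energy_convergent:
  assumes \<kappa>: "1 < \<kappa>" "\<kappa> < \<alpha> - 1"
  shows "convergent (\<lambda>k. \<kappa> * p k + H k)" "summable R"
proof -
  obtain c C N :: real where c: "0 < c" "0 \<le> C" "1 \<le> N" and
    desc: "\<And>k. N \<le> real k \<Longrightarrow> 2 \<le> k \<Longrightarrow> \<kappa> * p (Suc k) + H (Suc k)
       \<le> \<kappa> * p k + H k - c * R k + C / (real k)\<^sup>2 * (norm (z (Suc k) - zs))\<^sup>2"
    using energy_descent[OF \<kappa>] by blast
  define G where "G k = \<kappa> * p k + H k" for k
  define m where "m = \<kappa> * (\<alpha> - 1 - \<kappa>) / 2"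
  define B where "B = C / m"
  have m: "0 < m" using \<kappa> by (simp add: m_def)
  have B: "0 \<le> B" using m c by (simp add: B_def)
  have G: "m * (norm (z k - zs))\<^sup>2 \<le> G k" if "2 \<le> k" for k
    using energy_ge[OF that, of \<kappa>] \<kappa> by (simp add: m_def G_def)
  \<comment> \<open>\<open>M\<close> is past the threshold \<open>N\<close> of the descent and past
    index 2, and \<open>2 * B \<le> M\<close> makes the relative error at most 1/2.\<close>
  obtain M :: nat where M: "N \<le> real M" "2 * B \<le> real M" "2 \<le> M"
    using real_arch_simple[of "max N (max (2 * B) 2)"] by auto
  let ?c = "\<lambda>n. B / (real (n + M))\<^sup>2"
  have pos: "0 \<le> G (n + M)" for n
    using G[of "n + M"] M m by (smt (verit) mult_nonneg_nonneg trans_le_add2 zero_le_power2)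
  have half: "?c n \<le> 1 / 2" for n
  proof -
    have "2 * B \<le> real (n + M) * 1" using M by simp
    also have "\<dots> \<le> real (n + M) * real (n + M)" using M by (intro mult_left_mono) auto
    finally show ?thesis using M by (simp add: power2_eq_square divide_le_eq)
  qed
  have sum: "summable ?c"
  proof -
    have "summable (\<lambda>n. inverse ((real n)\<^sup>2))"
      using inverse_power_summable[of 2, where 'a=real] by simp
    then have "summable (\<lambda>n. inverse ((real (n + M))\<^sup>2))" by (rule summable_ignore_initial_segment)
    from summable_mult[OF this, of B] show ?thesis by (simp add: divide_inverse)
  qed
  have step: "G (Suc n + M) \<le> G (n + M) - c * R (n + M) + ?c n * G (Suc n + M)" for n
  proof -
    have "C / (real (n + M))\<^sup>2 * (norm (z (Suc n + M) - zs))\<^sup>2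
        = ?c n * (m * (norm (z (Suc n + M) - zs))\<^sup>2)"
      using m by (simp add: B_def)
    also have "\<dots> \<le> ?c n * G (Suc n + M)"
      using G[of "Suc n + M"] M B by (intro mult_left_mono) auto
    finally show ?thesis using desc[of "n + M"] M by (simp add: G_def)
  qed
  note * = perturbed_descent[of "\<lambda>n. G (n + M)" "\<lambda>n. c * R (n + M)" ?c,
      OF pos _ _ half sum step]
  have "convergent (\<lambda>n. G (n + M))" by (rule *(1)) (use c B R_nonneg in auto)
  then show "convergent (\<lambda>k. \<kappa> * p k + H k)"
    unfolding G_def convergent_def by (blast intro: LIMSEQ_offset)
  have "summable (\<lambda>n. c * R (n + M))" by (rule *(2)) (use c B R_nonneg in auto)
  then have "summable (\<lambda>n. R (n + M))" using c by (simp add: summable_cmult_iff)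
  then show "summable R" by (simp add: summable_iff_shift)
qed

text \<open>The energies for two parameters \<open>a < b\<close> are both convergent, and a fixed
  linear combination of them cancels \<open>p\<close> and returns \<open>H\<close>.\<close>

lemma H_convergent: "convergent H"
proof -
  \<comment> \<open>\<open>a\<close> and \<open>b\<close> cut the interval from 1 to \<alpha> - 1
    into thirds.\<close>
  define a where "a = (\<alpha> + 1) / 3"
  define b where "b = (2 * \<alpha> - 1) / 3"
  have ab: "1 < a" "a < b" "b < \<alpha> - 1" using \<alpha> by (auto simp: a_def b_def)
  have "convergent (\<lambda>k. b / (b - a) * (a * p k + H k) - a / (b - a) * (b * p k + H k))"
    by (intro convergent_diff convergent_mult_const_iff[THEN iffD2] energy_convergent)
       (use ab in auto)
  moreover have "b / (b - a) * (a * p k + H k) - a / (b - a) * (b * p k + H k) = H k" for k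
    using ab by (simp add: divide_simps) (simp add: algebra_simps)
  ultimately show ?thesis by simp
qed

section \<open>Vanishing limit and rates\<close>

text \<open>\<open>H (Suc k) / Suc k\<close> is at most a multiple of the summable dissipation
  \<open>R k\<close>, which excludes a positive limit.\<close>

lemma H_tendsto_0: "H \<longlonglongrightarrow> 0"
proof -
  define a where "a = (\<alpha> + 1) / 3"
  have a: "1 < a" "a < \<alpha> - 1" using \<alpha> by (auto simp: a_def)
  obtain l where l: "H \<longlonglongrightarrow> l" using H_convergent by (auto simp: convergent_def)
  have nonneg: "0 \<le> H k" if "2 \<le> k" for k using H_ge[OF that] by (smt (verit) zero_le_power2 divide_nonneg_nonneg)
  have le: "H (Suc k) / real (Suc k) \<le> 8 * R k" if "1 \<le> k" for k
  proof -
    let ?S = "(norm (d (Suc k)))\<^sup>2 + (norm (V (Suc k)))\<^sup>2 + (norm (D (Suc k)))\<^sup>2"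
    have "H (Suc k) / real (Suc k) \<le> 2 * real (Suc k) * ?S"
      using H_le[of "Suc k"] that
      by (simp add: divide_le_eq power2_eq_square mult_ac del: of_nat_Suc)
    also have "\<dots> \<le> 8 * real k * ?S"
      using that by (intro mult_right_mono) auto
    also have "\<dots> \<le> 8 * R k"
    proof -
      have "real k * (norm (D (Suc k)))\<^sup>2 \<le> (real k)\<^sup>2 * (norm (D (Suc k)))\<^sup>2"
        using that by (intro mult_right_mono) (auto simp: power2_eq_square)
      then show ?thesis by (simp add: R_def algebra_simps)
    qed
    finally show ?thesis .
  qed
  have "summable (\<lambda>n. H (n + 2) / real (n + 2))"
  proof (rule summable_comparison_test)
    show "summable (\<lambda>n. 8 * R (Suc n))"
      using summable_ignore_initial_segment[OF energy_convergent(2)[OF a], of 1]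
      by (intro summable_mult) simp
    show "\<exists>N. \<forall>n\<ge>N. norm (H (n + 2) / real (n + 2)) \<le> 8 * R (Suc n)"
      using le[of "Suc _"] nonneg[of "_ + 2"] by (intro exI[of _ 0]) (auto simp: add.commute)
  qed
  then have "summable (\<lambda>n. H n / real n)"
    using summable_iff_shift[of "\<lambda>n. H n / real n" 2] by blast
  then show ?thesis using l nonneg by (intro tendsto_zero_if_harmonic_summable) auto
qed

lemma V_rate: "(\<lambda>k. real k * norm (V k)) \<longlonglongrightarrow> 0"
proof -
  have "(\<lambda>k. 2 * sqrt (H k)) \<longlonglongrightarrow> 2 * sqrt 0" by (intro tendsto_intros H_tendsto_0)
  then have "(\<lambda>k. 2 * sqrt (H k)) \<longlonglongrightarrow> 0" by simp
  then show ?thesis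
  proof (rule Lim_null_comparison[rotated])
    show "\<forall>\<^sub>F k in sequentially. norm (real k * norm (V k)) \<le> 2 * sqrt (H k)"
      using eventually_ge_at_top[of 2]
    proof eventually_elim
      case (elim k)
      then have "(real k * norm (V k) / 2)\<^sup>2 \<le> H k" using H_ge[of k] by (simp add: power_divide)
      then have "real k * norm (V k) / 2 \<le> sqrt (H k)" by (rule real_le_rsqrt)
      then show ?case by simp
    qed
  qed
qed

text \<open>A convergent energy is bounded, and it dominates a positive multiple of the squared
  distance to \<open>zs\<close>. The gap estimate uses this bound.\<close>

lemma iterates_bounded: "\<exists>B. \<forall>\<^sub>F k in sequentially. norm (z k - zs) \<le> B"
proof -
  define a where "a = (\<alpha> + 1) / 3"
  have a: "1 < a" "a < \<alpha> - 1" using \<alpha> by (auto simp: a_def)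
  define m where "m = a * (\<alpha> - 1 - a) / 2"
  have m: "0 < m" using a by (simp add: m_def)
  obtain K where K: "\<And>k. norm (a * p k + H k) \<le> K"
    using convergent_imp_Bseq[OF energy_convergent(1)[OF a]] by (auto simp: Bseq_def)
  have "norm (z k - zs) \<le> sqrt (K / m)" if "2 \<le> k" for k
  proof (rule real_le_rsqrt)
    have "m * (norm (z k - zs))\<^sup>2 \<le> K"
      using energy_ge[OF that, of a] K[of k] a by (simp add: m_def)
    then show "(norm (z k - zs))\<^sup>2 \<le> K / m" using m by (simp add: field_simps)
  qed
  then show ?thesis by (meson eventually_sequentially)
qed

text \<open>\<open>e (Suc k)\<close> is bounded by \<open>|V (Suc k)| + |V k|\<close>, so it
  inherits the rate of \<open>V\<close>; the index shift costs a factor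
  \<open>Suc k / k \<le> 2\<close>.\<close>

lemma residual_rate: "(\<lambda>k. real k * norm (V k - e k)) \<longlonglongrightarrow> 0"
proof -
  have V1: "(\<lambda>k. real (Suc k) * norm (V (Suc k))) \<longlonglongrightarrow> 0"
    using V_rate by (rule LIMSEQ_Suc)
  have "(\<lambda>k. 2 * (real (Suc k) * norm (V (Suc k))) + 2 * (real k * norm (V k))) \<longlonglongrightarrow> 2 * 0 + 2 * 0"
    by (intro tendsto_intros V_rate V1)
  then have lim: "(\<lambda>k. 2 * (real (Suc k) * norm (V (Suc k))) + 2 * (real k * norm (V k))) \<longlonglongrightarrow> 0"
    by simp
  have "(\<lambda>k. real (Suc k) * norm (V (Suc k) - e (Suc k))) \<longlonglongrightarrow> 0"
  proof (rule Lim_null_comparison[OF _ lim])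
    show "\<forall>\<^sub>F k in sequentially. norm (real (Suc k) * norm (V (Suc k) - e (Suc k)))
        \<le> 2 * (real (Suc k) * norm (V (Suc k))) + 2 * (real k * norm (V k))"
      using eventually_ge_at_top[of 1]
    proof eventually_elim
      case (elim k)
      have "norm (V (Suc k) - e (Suc k)) \<le> norm (V (Suc k)) + norm (e (Suc k))"
        by (rule norm_triangle_ineq4)
      moreover have "norm (e (Suc k)) \<le> norm (V (Suc k)) + norm (V k)"
        using err[OF elim] \<theta> mult_right_mono[of \<theta> 1 "norm (V (Suc k) - V k)"]
          norm_triangle_ineq4[of "V (Suc k)" "V k"] by simp
      ultimately have "norm (V (Suc k) - e (Suc k)) \<le> 2 * norm (V (Suc k)) + norm (V k)" by simp
      then have "real (Suc k) * norm (V (Suc k) - e (Suc k))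
          \<le> real (Suc k) * (2 * norm (V (Suc k)) + norm (V k))"
        by (rule mult_left_mono) simp
      moreover have "real (Suc k) * norm (V k) \<le> 2 * real k * norm (V k)"
        using elim by (intro mult_right_mono) auto
      ultimately show ?case by (simp add: algebra_simps)
    qed
  qed
  then show ?thesis by (rule LIMSEQ_imp_Suc)
qed

end

section \<open>Gap and residual in terms of normal vectors\<close>

lemma closest_point_normal_cone:
  fixes C :: "'a::euclidean_space set"
  assumes "closed C" "convex C" "\<zeta> \<in> normal_cone C z"
  shows "closest_point C (z + \<zeta>) = z"
proof (rule closest_point_unique[symmetric])
  show "z \<in> C" using assms(3) by (auto simp: normal_cone_def split: if_splits)
  show "\<forall>y\<in>C. dist (z + \<zeta>) z \<le> dist (z + \<zeta>) y"
  proof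
    fix y assume "y \<in> C"
    then have "inner (y - z) \<zeta> \<le> 0" using assms(3) by (auto simp: normal_cone_def split: if_splits)
    moreover have "(norm (\<zeta> - (y - z)))\<^sup>2 = (norm \<zeta>)\<^sup>2 - 2 * inner (y - z) \<zeta> + (norm (y - z))\<^sup>2"
      unfolding power2_norm_eq_inner by (simp add: inner_diff inner_commute)
    ultimately have "(norm \<zeta>)\<^sup>2 \<le> (norm (\<zeta> - (y - z)))\<^sup>2"
      using zero_le_power2[of "norm (y - z)"] by linarith
    then have "norm \<zeta> \<le> norm (\<zeta> - (y - z))" by (rule power2_le_imp_le) simp
    then show "dist (z + \<zeta>) z \<le> dist (z + \<zeta>) y" by (simp add: dist_norm algebra_simps)
  qed
qed (use assms in auto)

text \<open>Since \<open>z\<close> is the projection of \<open>z + \<zeta>\<close>, the residual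
  compares two projections whose arguments differ by \<open>F z + \<zeta>\<close>; projections are
  nonexpansive.\<close>

lemma natural_residual_le:
  fixes C :: "'a::euclidean_space set"
  assumes "closed C" "convex C" "\<zeta> \<in> normal_cone C z"
  shows "natural_residual F C z \<le> norm (F z + \<zeta>)"
proof -
  have "C \<noteq> {}" using assms(3) by (auto simp: normal_cone_def split: if_splits)
  then have "dist (closest_point C (z + \<zeta>)) (closest_point C (z - F z)) \<le> dist (z + \<zeta>) (z - F z)"
    using assms by (intro closest_point_lipschitz)
  then show ?thesis
    using closest_point_normal_cone[OF assms]
    by (simp add: natural_residual_def dist_norm algebra_simps)
qed

text \<open>Monotonicity replaces \<open>F v\<close> by \<open>F z\<close>, the normal cone
  inequality adds \<zeta>, and Cauchy-Schwarz gives a bound uniform over the ball. The lower bound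
  comes from testing with \<open>v = zs\<close>.\<close>

lemma restricted_gap_bounds:
  assumes F: "monotone_operator F" and \<zeta>: "\<zeta> \<in> normal_cone C z" and zs: "zs \<in> vi_solutions F C"
  shows "0 \<le> restricted_gap F C zs z0 z"
    and "restricted_gap F C zs z0 z \<le> norm (F z + \<zeta>) * (norm (z - zs) + norm (zs - z0))"
proof -
  have z: "z \<in> C" and n: "\<And>v. v \<in> C \<Longrightarrow> inner (v - z) \<zeta> \<le> 0"
    using \<zeta> by (auto simp: normal_cone_def split: if_splits)
  have zsC: "zs \<in> C" and sol: "0 \<le> inner (F zs) (z - zs)"
    using zs z by (auto simp: vi_solutions_def)
  let ?B = "norm (F z + \<zeta>) * (norm (z - zs) + norm (zs - z0))"
  have le: "inner (F v) (z - v) \<le> ?B" if "v \<in> C \<inter> cball zs (norm (zs - z0))" for v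
  proof -
    have "0 \<le> inner (F z - F v) (z - v)" using F by (simp add: monotone_operator_def)
    moreover have "inner (v - z) \<zeta> \<le> 0" using n that by simp
    ultimately have "inner (F v) (z - v) \<le> inner (F z + \<zeta>) (z - v)"
      by (simp add: inner_simps inner_commute)
    also have "\<dots> \<le> norm (F z + \<zeta>) * norm (z - v)" by (rule norm_cauchy_schwarz)
    also have "\<dots> \<le> ?B"
    proof (rule mult_left_mono)
      show "norm (z - v) \<le> norm (z - zs) + norm (zs - z0)"
        using norm_triangle_ineq[of "z - zs" "zs - v"] that by (simp add: dist_norm)
    qed simp
    finally show ?thesis .
  qed
  have zs_mem: "zs \<in> C \<inter> cball zs (norm (zs - z0))" using zsC by simp
  show "restricted_gap F C zs z0 z \<le> ?B"
    unfolding restricted_gap_def using zs_mem le by (intro cSUP_least) blast+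
  have "inner (F zs) (z - zs) \<le> restricted_gap F C zs z0 z"
    unfolding restricted_gap_def using zs_mem le by (intro cSUP_upper bdd_aboveI2) blast+
  then show "0 \<le> restricted_gap F C zs z0 z" using sol by linarith
qed

lemma smallo_inverse_natI:
  fixes f :: "nat \<Rightarrow> real"
  assumes "(\<lambda>k. real k * f k) \<longlonglongrightarrow> 0"
  shows "f \<in> o(\<lambda>k. 1 / real k)"
  \<comment> \<open>Index 0 must be avoided, since there \<open>1 / real k\<close> is 0 and the
    quotient criterion fails.\<close>
  using assms eventually_gt_at_top[of 0]
  by (intro smalloI_tendsto) (auto simp: mult.commute elim: eventually_mono)

section \<open>The algorithm as an instance of the recursion\<close>

context
  fixes F :: "'a::euclidean_space \<Rightarrow> 'a" and C :: "'a set" and L \<alpha> \<gamma> :: real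
    and z w \<zeta> :: "nat \<Rightarrow> 'a" and zs :: 'a
  assumes F: "monotone_operator F" and L: "L > 0" and lip: "L-lipschitz_on UNIV F"
    and C: "closed C" "convex C"
    and zs: "zs \<in> vi_solutions F C"
    and \<alpha>: "\<alpha> > 2" and \<gamma>: "0 < \<gamma>" "\<gamma> < 1 / (4 * L)"
    and alg: "fogda_vi F C \<alpha> \<gamma> z w \<zeta>"
begin

text \<open>A point minus its projection is normal to \<open>C\<close> at the projection, and the
  update of \<zeta> is this difference divided by the step size \<open>s\<close>.\<close>

lemma fogda_normal_cone: "1 \<le> k \<Longrightarrow> \<zeta> k \<in> normal_cone C (z k)"
proof (induction k rule: dec_induct)
  case base
  then show ?case using alg by (simp add: fogda_vi_def)
next
  case (step k)
  define s where "s = \<gamma> * (1 + real k / (real k + \<alpha>))"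
  define g where "g = F (w k) - F (w (k - 1)) - \<zeta> k"
  have s: "0 < s" using \<gamma> \<alpha> by (simp add: s_def add_pos_nonneg)
  have s': "(real k + \<alpha>) / (\<gamma> * (2 * real k + \<alpha>)) = 1 / s"
    using \<gamma> \<alpha> by (simp add: s_def field_simps)
  have z: "z (Suc k) = closest_point C (w k - s *\<^sub>R g)"
    and \<zeta>: "\<zeta> (Suc k) = (1 / s) *\<^sub>R (w k - z (Suc k)) - g"
    using alg step unfolding fogda_vi_def s'[symmetric] by (simp_all add: s_def g_def)
  have "C \<noteq> {}" using zs by (auto simp: vi_solutions_def)
  then have "z (Suc k) \<in> C" unfolding z using C by (intro closest_point_in_set)
  moreover have "inner (v - z (Suc k)) (\<zeta> (Suc k)) \<le> 0" if "v \<in> C" for v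
  proof -
    have "inner (w k - s *\<^sub>R g - z (Suc k)) (v - z (Suc k)) \<le> 0"
      unfolding z using C that by (intro closest_point_dot) auto
    moreover have "\<zeta> (Suc k) = (1 / s) *\<^sub>R (w k - s *\<^sub>R g - z (Suc k))"
      using s unfolding \<zeta> by (simp add: algebra_simps)
    ultimately show ?thesis using s
      by (simp add: inner_commute divide_nonpos_pos mult_nonneg_nonpos)
  qed
  ultimately show ?case by (simp add: normal_cone_def)
qed

text \<open>In \<open>V (Suc k) - V k\<close> the old operator values cancel and a multiple of
  \<open>w k - z (Suc k)\<close> remains; eliminating \<open>w k\<close> with its own update gives
  the recursion.\<close>

lemma fogda_recursion:
  fixes V e :: "nat \<Rightarrow> 'a"
  defines "V \<equiv> \<lambda>k. \<gamma> *\<^sub>R (F (w (k - 1)) + \<zeta> k)"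
    and "e \<equiv> \<lambda>k. \<gamma> *\<^sub>R (F (w (k - 1)) - F (z k))"
  shows "inertial_recursion z V e zs \<alpha> (2 * \<gamma> * L)"
proof
  have VE: "V k - e k = \<gamma> *\<^sub>R (F (z k) + \<zeta> k)" for k
    by (simp add: V_def e_def algebra_simps)
  show "2 < \<alpha>" "0 \<le> 2 * \<gamma> * L" "2 * \<gamma> * L < 1/2"
    using \<alpha> \<gamma> L by (auto simp: field_simps)
  fix k :: nat assume k: "1 \<le> k"
  have nc: "z k \<in> C" "\<And>v. v \<in> C \<Longrightarrow> inner (v - z k) (\<zeta> k) \<le> 0"
    using fogda_normal_cone[OF k] by (auto simp: normal_cone_def split: if_splits)
  have nc': "z (Suc k) \<in> C" "\<And>v. v \<in> C \<Longrightarrow> inner (v - z (Suc k)) (\<zeta> (Suc k)) \<le> 0"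
    using fogda_normal_cone[of "Suc k"] by (auto simp: normal_cone_def split: if_splits)
  have ka: "0 < real k + \<alpha>" "0 < 2 * real k + \<alpha>" using \<alpha> by auto
  have w: "w k = z k + (real k / (real k + \<alpha>)) *\<^sub>R (z k - z (k - 1)) - (\<alpha> / (real k + \<alpha>)) *\<^sub>R V k"
    and \<zeta>: "\<zeta> (Suc k) = ((real k + \<alpha>) / (\<gamma> * (2 * real k + \<alpha>))) *\<^sub>R (w k - z (Suc k))
      - (F (w k) - F (w (k - 1)) - \<zeta> k)"
    using alg k by (simp_all add: fogda_vi_def V_def mult.commute)
  have "V (Suc k) - V k = \<gamma> *\<^sub>R (((real k + \<alpha>) / (\<gamma> * (2 * real k + \<alpha>))) *\<^sub>R (w k - z (Suc k)))"
    unfolding V_def \<zeta> by (simp add: algebra_simps)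
  then have "V (Suc k) - V k = ((real k + \<alpha>) / (2 * real k + \<alpha>)) *\<^sub>R (w k - z (Suc k))"
    using \<gamma> by simp
  then have wz: "(2 * real k + \<alpha>) *\<^sub>R (V (Suc k) - V k) = (real k + \<alpha>) *\<^sub>R (w k - z (Suc k))"
    using ka by simp
  have w': "(real k + \<alpha>) *\<^sub>R w k = (real k + \<alpha>) *\<^sub>R z k + real k *\<^sub>R (z k - z (k - 1)) - \<alpha> *\<^sub>R V k"
    using ka unfolding w by (simp add: scaleR_add_right scaleR_diff_right)
  show "(real k + \<alpha>) *\<^sub>R (z (Suc k) - z k) = real k *\<^sub>R (z k - z (k - 1))
      - \<alpha> *\<^sub>R V (Suc k) - (2 * real k) *\<^sub>R (V (Suc k) - V k)"
  proof -
    have "(real k + \<alpha>) *\<^sub>R (z (Suc k) - z k)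
      = (real k + \<alpha>) *\<^sub>R w k - (real k + \<alpha>) *\<^sub>R (w k - z (Suc k)) - (real k + \<alpha>) *\<^sub>R z k"
      by (simp add: algebra_simps)
    then show ?thesis unfolding wz[symmetric] w' by (simp add: algebra_simps)
  qed
  \<comment> \<open>The ratio \<open>(2k + \<alpha>) / (k + \<alpha>)\<close> is at most 2, whence
    the factor 2 in \<theta> = 2\<gamma>L; the step size bound makes it less than 1/2.\<close>
  show "norm (e (Suc k)) \<le> 2 * \<gamma> * L * norm (V (Suc k) - V k)"
  proof -
    have "norm ((real k + \<alpha>) *\<^sub>R (w k - z (Suc k))) = norm ((2 * real k + \<alpha>) *\<^sub>R (V (Suc k) - V k))"
      unfolding wz ..
    then have "(real k + \<alpha>) * norm (w k - z (Suc k)) = (2 * real k + \<alpha>) * norm (V (Suc k) - V k)"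
      using ka by simp
    also have "\<dots> \<le> (real k + \<alpha>) * (2 * norm (V (Suc k) - V k))"
      using \<alpha> mult_right_mono[of "2 * real k + \<alpha>" "2 * (real k + \<alpha>)" "norm (V (Suc k) - V k)"]
      by (simp add: algebra_simps)
    finally have "norm (w k - z (Suc k)) \<le> 2 * norm (V (Suc k) - V k)" using ka by simp
    moreover have "norm (F (w k) - F (z (Suc k))) \<le> L * norm (w k - z (Suc k))"
      using lipschitz_onD[OF lip, of "w k" "z (Suc k)"] by (simp add: dist_norm)
    ultimately have "norm (F (w k) - F (z (Suc k))) \<le> L * (2 * norm (V (Suc k) - V k))"
      using L by (meson mult_left_mono order_trans less_imp_le)
    from mult_left_mono[OF this, of \<gamma>] show ?thesis using \<gamma> by (simp add: e_def mult_ac)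
  qed
  \<comment> \<open>Each of the two normal cone inequalities is tested with the other
    iterate.\<close>
  show "0 \<le> inner (z (Suc k) - z k) ((V (Suc k) - e (Suc k)) - (V k - e k))"
  proof -
    have "0 \<le> inner (F (z (Suc k)) - F (z k)) (z (Suc k) - z k)"
      using F by (simp add: monotone_operator_def)
    then have "0 \<le> inner (z (Suc k) - z k) (F (z (Suc k)) + \<zeta> (Suc k) - (F (z k) + \<zeta> k))"
      using nc(2)[OF nc'(1)] nc'(2)[OF nc(1)] by (simp add: inner_simps inner_commute)
    then show ?thesis using \<gamma> unfolding VE scaleR_diff_right[symmetric] by simp
  qed
  show "0 \<le> inner (z k - zs) (V k - e k)"
  proof -
    have "0 \<le> inner (F (z k) - F zs) (z k - zs)" using F by (simp add: monotone_operator_def)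
    moreover have "0 \<le> inner (F zs) (z k - zs)" "zs \<in> C" using zs nc by (auto simp: vi_solutions_def)
    ultimately have "0 \<le> inner (z k - zs) (F (z k) + \<zeta> k)"
      using nc(2)[of zs] by (simp add: inner_simps inner_commute)
    then show ?thesis using \<gamma> unfolding VE by simp
  qed
qed

lemma fogda_rates:
  "(\<lambda>k. restricted_gap F C zs (z 0) (z k)) \<in> o(\<lambda>k. 1 / real k)"
  "(\<lambda>k. natural_residual F C (z k)) \<in> o(\<lambda>k. 1 / real k)"
proof -
  interpret inertial_recursion z "\<lambda>k. \<gamma> *\<^sub>R (F (w (k - 1)) + \<zeta> k)"
    "\<lambda>k. \<gamma> *\<^sub>R (F (w (k - 1)) - F (z k))" zs \<alpha> "2 * \<gamma> * L"
    by (rule fogda_recursion)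
  \<comment> \<open>\<open>V k - e k\<close> is \<gamma> times \<open>F (z k) + \<zeta> k\<close>,
    so \<open>residual_rate\<close> is a rate for \<open>U\<close>, and \<open>U\<close> bounds both
    measures.\<close>
  define U where "U k = norm (F (z k) + \<zeta> k)" for k
  have "norm (\<gamma> *\<^sub>R (F (w (k - 1)) + \<zeta> k) - \<gamma> *\<^sub>R (F (w (k - 1)) - F (z k))) = \<gamma> * U k" for k
    using \<gamma> by (simp add: U_def scaleR_diff_right[symmetric] add.commute)
  then have "(\<lambda>k. (1 / \<gamma>) * (real k * (\<gamma> * U k))) \<longlonglongrightarrow> (1 / \<gamma>) * 0"
    using residual_rate by (intro tendsto_intros) simp
  then have U: "(\<lambda>k. real k * U k) \<longlonglongrightarrow> 0" using \<gamma> by simp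
  show "(\<lambda>k. natural_residual F C (z k)) \<in> o(\<lambda>k. 1 / real k)"
  proof (intro smallo_inverse_natI Lim_null_comparison[OF _ U])
    show "\<forall>\<^sub>F k in sequentially. norm (real k * natural_residual F C (z k)) \<le> real k * U k"
      using eventually_ge_at_top[of 1]
    proof eventually_elim
      case (elim k)
      have "0 \<le> natural_residual F C (z k)" by (simp add: natural_residual_def)
      moreover have "natural_residual F C (z k) \<le> U k"
        unfolding U_def by (rule natural_residual_le[OF C fogda_normal_cone[OF elim]])
      ultimately show ?case by (simp add: abs_mult mult_left_mono)
    qed
  qed
  obtain B where B: "\<forall>\<^sub>F k in sequentially. norm (z k - zs) \<le> B" using iterates_bounded by blast
  define K where "K = B + norm (zs - z 0)"
  have UK: "(\<lambda>k. real k * U k * K) \<longlonglongrightarrow> 0"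
    using tendsto_mult_right[OF U, of K] by simp
  show "(\<lambda>k. restricted_gap F C zs (z 0) (z k)) \<in> o(\<lambda>k. 1 / real k)"
  proof (intro smallo_inverse_natI Lim_null_comparison[OF _ UK])
    show "\<forall>\<^sub>F k in sequentially. norm (real k * restricted_gap F C zs (z 0) (z k)) \<le> real k * U k * K"
      using B eventually_ge_at_top[of 1]
    proof eventually_elim
      case (elim k)
      note bounds = restricted_gap_bounds[OF F fogda_normal_cone[OF elim(2)] zs, of "z 0"]
      have "restricted_gap F C zs (z 0) (z k) \<le> U k * (norm (z k - zs) + norm (zs - z 0))"
        using bounds(2) by (simp add: U_def)
      also have "\<dots> \<le> U k * K"
        using elim by (intro mult_left_mono) (auto simp: K_def U_def)
      finally have "real k * restricted_gap F C zs (z 0) (z k) \<le> real k * (U k * K)"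
        by (rule mult_left_mono) simp
      then show ?case using bounds(1) by (simp add: mult_ac)
    qed
  qed
qed

end

theorem theorem3p3:
  fixes F :: "real ^ 'd \<Rightarrow> real ^ 'd"
    and C :: "(real ^ 'd) set"
    and L \<alpha> \<gamma> :: real
    and z w \<zeta> :: "nat \<Rightarrow> real ^ 'd"
    and zs :: "real ^ 'd"
  assumes "monotone_operator F"
    and "L > 0" and "L-lipschitz_on UNIV F"
    and "C \<noteq> {}" and "closed C" and "convex C"
    and "zs \<in> vi_solutions F C"
    and "\<alpha> > 2" and "0 < \<gamma>" and "\<gamma> < 1 / (4 * L)"
    and "fogda_vi F C \<alpha> \<gamma> z w \<zeta>"
  shows "(\<lambda>k. restricted_gap F C zs (z 0) (z k)) \<in> o(\<lambda>k. 1 / real k) \<and>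
         (\<lambda>k. natural_residual F C (z k)) \<in> o(\<lambda>k. 1 / real k)"
  using fogda_rates[OF assms(1-3,5-)] by blast

end
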